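(* Fix an event index $n\ge 0$ and an actor state $s_n\in S_A$. Suppose that $\mathcal D(s_n)$ is non-empty and that $\mathfrak J(s_n,K)$ is non-empty for every $K\in\mathcal D(s_n)$. Let $$\mathfrak C(s_n)=\bigcup_{K\in\mathcal D(s_n)}\mathfrak J(s_n,K).$$ Then $\mathfrak C(s_n)$ is a singleton if and only if there are a unique admissible event kernel $K^\star$ and a unique compatible joint state/waiting-time kernel $\mathcal J^\star$ for it, that is, $$\mathcal D(s_n)=\{K^\star\},\qquad \mathfrak J(s_n,K^\star)=\{\mathcal J^\star\}.$$ Consequently, if either $\mathcal D(s_n)$ has more than one element, or $\mathfrak J(s_n,K)$ has more than one element for some $K\in\mathcal D(s_n)$, then $\mathfrak C(s_n)$ is not a singleton.
   Context: $(\mathsf X,\mathcal X)$ is a measurable space (the lower-level state space), $(S_A,\mathcal S_A)$ is a measurable space (the actor-state space), and $\mathcal K(\mathsf X)$ is the set of Markov (probability) transition kernels on $(\mathsf X,\mathcal X)$. $\mathcal D:S_A\rightrightarrows\mathcal K(\mathsf X)$ is a set-valued map; $\mathcal D(s)\subseteq\mathcal K(\mathsf X)$ is the set of "admissible event kernels" at actor state $s$. For an actor state $s$ and $K\in\mathcal D(s)$, the compatible family of joint state/waiting-time kernels is a set $\mathfrak J(s,K)=\{\mathcal J^{\vartheta}_{s,K}:\vartheta\in\Theta\}$, where $\Theta$ is an index set of timing specifications. Each $\mathcal J^{\vartheta}_{s,K}$ is a probability kernel from $\mathsf X$ to $\mathsf X\times(0,\infty)$ (product of $\mathcal X$ with the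 Borel $\sigma$-field) whose state marginal is $K$: $$\mathcal J^{\vartheta}_{s,K}\bigl(x,B\times(0,\infty)\bigr)=K(x,B)\qquad\text{for all }x\in\mathsf X,\ B\in\mathcal X,\ \vartheta\in\Theta.$$ $\mathfrak J(s,K)$ is otherwise an arbitrary prescribed family (not necessarily all kernels with this marginal), and is regarded as a set of kernels, so that kernels which coincide count once. *)

theory Defs
  imports "HOL-Probability.Probability"
begin

text \<open>Measurable spaces are represented by values of type \<open>'a measure\<close>, of which only \<open>space\<close> and
  \<open>sets\<close> are used.\<close>

text \<open>Kernels are compared for equality below, so the values of the representing function outside
  the source space are normalised by \<open>extensional\<close>: two kernels are equal iff they assign
  the same measure to every point of the source space.\<close>

definition markov_kernels :: "'a measure \<Rightarrow> 'b measure \<Rightarrow> ('a \<Rightarrow> 'b measure) set" where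
  "markov_kernels M N = (M \<rightarrow>\<^sub>M prob_algebra N) \<inter> extensional (space M)"

definition state_time_space :: "'x measure \<Rightarrow> ('x \<times> real) measure" where
  "state_time_space X = X \<Otimes>\<^sub>M restrict_space borel {0<..}"

definition has_state_marginal ::
    "'x measure \<Rightarrow> ('x \<Rightarrow> ('x \<times> real) measure) \<Rightarrow> ('x \<Rightarrow> 'x measure) \<Rightarrow> bool" where
  "has_state_marginal X J K \<longleftrightarrow>
     (\<forall>x\<in>space X. \<forall>B\<in>sets X. emeasure (J x) (B \<times> {0<..}) = emeasure (K x) B)"

text \<open>\<open>J s K \<theta>\<close> is the joint kernel with timing specification \<open>\<theta>\<close>; taking the image over the index
  set \<open>\<Theta>\<close> identifies specifications that yield the same kernel.\<close>

definition compatible_family ::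
    "'t set \<Rightarrow> ('s \<Rightarrow> ('x \<Rightarrow> 'x measure) \<Rightarrow> 't \<Rightarrow> 'x \<Rightarrow> ('x \<times> real) measure)
      \<Rightarrow> 's \<Rightarrow> ('x \<Rightarrow> 'x measure) \<Rightarrow> ('x \<Rightarrow> ('x \<times> real) measure) set" where
  "compatible_family \<Theta> J s K = {J s K \<theta> | \<theta>. \<theta> \<in> \<Theta>}"

definition joint_candidates ::
    "('s \<Rightarrow> ('x \<Rightarrow> 'x measure) set) \<Rightarrow> 't set
      \<Rightarrow> ('s \<Rightarrow> ('x \<Rightarrow> 'x measure) \<Rightarrow> 't \<Rightarrow> 'x \<Rightarrow> ('x \<times> real) measure)
      \<Rightarrow> 's \<Rightarrow> ('x \<Rightarrow> ('x \<times> real) measure) set" where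
  "joint_candidates D \<Theta> J s = (\<Union>K\<in>D s. compatible_family \<Theta> J s K)"

end

theory Submission
  imports Defs
begin

text \<open>A joint kernel determines its state marginal, so the compatible families of distinct event
  kernels are disjoint; a union of disjoint non-empty sets is a singleton only if there is a
  single set in the union and that set is a singleton.\<close>

text \<open>Off \<open>space M\<close> both functions are \<open>undefined\<close> by
  extensionality, so only points of \<open>space M\<close> matter; there the two measures agree on a
  common \<sigma>-algebra.\<close>

lemma markov_kernels_eqI:
  assumes "K \<in> markov_kernels M N" "K' \<in> markov_kernels M N"
    and "\<And>x B. x \<in> space M \<Longrightarrow> B \<in> sets N \<Longrightarrow> emeasure (K x) B = emeasure (K' x) B"
  shows "K = K'"
proof (rule extensionalityI)
  show "K \<in> extensional (space M)" "K' \<in> extensional (space M)"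
    using assms(1,2) by (auto simp: markov_kernels_def)
next
  fix x assume x: "x \<in> space M"
  \<comment> \<open>Membership in \<open>prob_algebra N\<close> fixes the \<sigma>-algebra of each
    value to be \<open>sets N\<close>, which is what \<open>measure_eqI\<close> requires besides
    equal values.\<close>
  have "K x \<in> space (prob_algebra N)" "K' x \<in> space (prob_algebra N)"
    using assms(1,2) x by (auto simp: markov_kernels_def dest: measurable_space)
  then have "sets (K x) = sets N" "sets (K' x) = sets N"
    by (simp_all add: space_prob_algebra)
  then show "K x = K' x"
    using assms(3)[OF x] by (intro measure_eqI) auto
qed

text \<open>Both \<open>K x B\<close> and \<open>K' x B\<close> equal the mass that
  \<open>L x\<close> gives to the cylinder \<open>B \<times> {0<..}\<close>.\<close>

lemma has_state_marginal_unique: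
  assumes "K \<in> markov_kernels X X" "K' \<in> markov_kernels X X"
    and "has_state_marginal X L K" "has_state_marginal X L K'"
  shows "K = K'"
proof (rule markov_kernels_eqI[OF assms(1,2)])
  show "emeasure (K x) B = emeasure (K' x) B" if "x \<in> space X" "B \<in> sets X" for x B
    using assms(3,4) that by (metis has_state_marginal_def)
qed

text \<open>Disjointness is phrased through indices, so that the conclusion is about
  \<open>I\<close> itself and not merely about the collection of sets \<open>F i\<close>.\<close>

lemma is_singleton_UN_disjoint_iff:
  assumes "\<And>i. i \<in> I \<Longrightarrow> F i \<noteq> {}"
    and "\<And>i j x. i \<in> I \<Longrightarrow> j \<in> I \<Longrightarrow> x \<in> F i \<Longrightarrow> x \<in> F j \<Longrightarrow> i = j"
  shows "is_singleton (\<Union>i\<in>I. F i) \<longleftrightarrow> (\<exists>i x. I = {i} \<and> F i = {x})"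
proof
  assume "is_singleton (\<Union>i\<in>I. F i)"
  then obtain x where x: "(\<Union>i\<in>I. F i) = {x}"
    by (auto simp: is_singleton_def)
  then have F: "F i = {x}" if "i \<in> I" for i
    using assms(1)[OF that] that by (metis UN_upper subset_singletonD)
  obtain i where i: "i \<in> I"
    using x by blast
  \<comment> \<open>Every index \<open>j\<close> in \<open>I\<close> has \<open>x\<close> in
    \<open>F j\<close>, so a second index would share \<open>x\<close> with
    \<open>i\<close>.\<close>
  then have "I = {i}"
    using F assms(2) by blast
  then show "\<exists>i x. I = {i} \<and> F i = {x}"
    using F[OF i] by blast
qed (auto simp: is_singleton_def)

theorem proposition3:
  fixes X :: "'x measure"
    and S :: "'s measure"
    and D :: "'s \<Rightarrow> ('x \<Rightarrow> 'x measure) set"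
    and \<Theta> :: "'t set"
    and J :: "'s \<Rightarrow> ('x \<Rightarrow> 'x measure) \<Rightarrow> 't \<Rightarrow> 'x \<Rightarrow> ('x \<times> real) measure"
    and s :: "nat \<Rightarrow> 's"
    and n :: nat
  assumes "\<And>a. a \<in> space S \<Longrightarrow> D a \<subseteq> markov_kernels X X"
    and "\<And>a K \<theta>. a \<in> space S \<Longrightarrow> K \<in> D a \<Longrightarrow> \<theta> \<in> \<Theta> \<Longrightarrow>
           J a K \<theta> \<in> markov_kernels X (state_time_space X)"
    and "\<And>a K \<theta>. a \<in> space S \<Longrightarrow> K \<in> D a \<Longrightarrow> \<theta> \<in> \<Theta> \<Longrightarrow>
           has_state_marginal X (J a K \<theta>) K"
    and "s n \<in> space S"
    and "D (s n) \<noteq> {}"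
    and "\<And>K. K \<in> D (s n) \<Longrightarrow> compatible_family \<Theta> J (s n) K \<noteq> {}"
  shows "(is_singleton (joint_candidates D \<Theta> J (s n)) \<longleftrightarrow>
            (\<exists>Kstar Jstar. D (s n) = {Kstar} \<and> compatible_family \<Theta> J (s n) Kstar = {Jstar})) \<and>
         ((\<exists>K\<in>D (s n). \<exists>K'\<in>D (s n). K \<noteq> K') \<or>
            (\<exists>K\<in>D (s n). \<exists>L\<in>compatible_family \<Theta> J (s n) K.
               \<exists>L'\<in>compatible_family \<Theta> J (s n) K. L \<noteq> L') \<longrightarrow>
          \<not> is_singleton (joint_candidates D \<Theta> J (s n)))"
proof -
  \<comment> \<open>The timing specifications producing \<open>L\<close> from \<open>K\<close> and
    from \<open>K'\<close> may differ; only the kernel \<open>L\<close> itself enters the marginal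
    condition.\<close>
  have disjoint: "K = K'"
    if "K \<in> D (s n)" "K' \<in> D (s n)"
      "L \<in> compatible_family \<Theta> J (s n) K" "L \<in> compatible_family \<Theta> J (s n) K'" for K K' L
  proof (rule has_state_marginal_unique)
    show "K \<in> markov_kernels X X" "K' \<in> markov_kernels X X"
      using assms(1)[OF assms(4)] that by auto
    show "has_state_marginal X L K" "has_state_marginal X L K'"
      using assms(3)[OF assms(4)] that by (auto simp: compatible_family_def)
  qed
  have iff: "is_singleton (joint_candidates D \<Theta> J (s n)) \<longleftrightarrow>
      (\<exists>Kstar Jstar. D (s n) = {Kstar} \<and> compatible_family \<Theta> J (s n) Kstar = {Jstar})"
    unfolding joint_candidates_def
    using assms(6) disjoint by (rule is_singleton_UN_disjoint_iff)
  \<comment> \<open>Two distinct elements of \<open>D (s n)\<close>, or of one compatible family,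
    contradict the singleton equations on the right of \<open>iff\<close>.\<close>
  then show ?thesis
    by auto
qed

end
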